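(* Consider the maximum coverage setting: clients $C_1,\dots,C_N$, groups $E=\{G_1,\dots,G_n\}$ with $G_a\subseteq\{C_1,\dots,C_N\}$, and for $A\subseteq[n]$ let $f_i(A)=1$ if there is $a\in A$ with $C_i\in G_a$ and $f_i(A)=0$ otherwise; let $F=\sum_{i=1}^Nf_i$ and $\texttt{OPT}=\max_{A\subseteq[n],|A|\le k}F(A)$. Suppose each client has importance factor $w_i=\max_{a:\,C_i\in G_a}\frac{1}{|G_a|}$, and let $\varepsilon\in(0,1)$. Then Algorithm Federated Discrete Greedy, run on the uniform matroid of rank $k$ with an appropriate $\kappa=\tilde O(kn/\varepsilon^2)$, after $k$ communication rounds returns a set $S\subseteq E$ of size $k$ such that with probability at least $1-1/n$, $(1-1/\mathrm{e}-\varepsilon)\texttt{OPT}\le F(S)$. Moreover, the expected number of clients participating during each round is $\tilde O(kn^2/\varepsilon^2)$.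
   Context: Algorithm Federated Discrete Greedy (matroid $\mathcal{M}=(E,\mathcal{I})$ of rank $r$, here the uniform matroid $\{S:|S|\le k\}$ with $r=k$): set $S=\emptyset$. For $t=0,\dots,r-1$: the server sends $S$ to all clients; each client $i$ sets $\kappa_i=\min\{\kappa w_i,1\}$, computes $\Delta_i[e]=(f_i(S\cup\{e\})-f_i(S))/\kappa_i$ for all $e$ with $S\cup\{e\}\in\mathcal{I}$, and independently with probability $\kappa_i$ sends $\Delta_i$ to a secure aggregator (otherwise nothing); the aggregator computes the sum $\Delta^{(t)}$ of received vectors; the server adds $\arg\max_{e:S\cup\{e\}\in\mathcal{I}}\Delta^{(t)}[e]$ to $S$. Output $S$. *)

theory Defs
  imports "HOL-Probability.Probability" "HOL-Probability.Product_PMF"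
begin

(* f = O~(g), uniformly over the parameter set X: the hidden factor is polylogarithmic in g.
   The shift by 2 keeps the logarithm bounded away from 0 where g is small. *)
definition soft_O :: "'a set \<Rightarrow> ('a \<Rightarrow> real) \<Rightarrow> ('a \<Rightarrow> real) \<Rightarrow> bool" where
  "soft_O X f g \<longleftrightarrow>
     (\<exists>C>0. \<exists>p::nat. \<forall>x\<in>X. \<bar>f x\<bar> \<le> C * \<bar>g x\<bar> * ln (2 + \<bar>g x\<bar>) ^ p)"

definition uniform_indep :: "'e set \<Rightarrow> nat \<Rightarrow> 'e set set" where
  "uniform_indep E k = {S. S \<subseteq> E \<and> finite S \<and> card S \<le> k}"

(* A rule selecting a maximiser of a vector over a candidate set; ties are broken arbitrarily. *)
definition argmax_rule :: "(('e \<Rightarrow> real) \<Rightarrow> 'e set \<Rightarrow> 'e) \<Rightarrow> bool" where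
  "argmax_rule sel \<longleftrightarrow>
     (\<forall>\<Delta> A. finite A \<and> A \<noteq> {} \<longrightarrow> is_arg_max \<Delta> (\<lambda>e. e \<in> A) (sel \<Delta> A))"

definition send_prob :: "real \<Rightarrow> (nat \<Rightarrow> real) \<Rightarrow> nat \<Rightarrow> real" where
  "send_prob \<kappa> w i = min (\<kappa> * w i) 1"

definition client_vector ::
  "(nat \<Rightarrow> 'e set \<Rightarrow> real) \<Rightarrow> (nat \<Rightarrow> real) \<Rightarrow> real \<Rightarrow> 'e set \<Rightarrow> nat \<Rightarrow> 'e \<Rightarrow> real" where
  "client_vector f w \<kappa> S i e = (f i (insert e S) - f i S) / send_prob \<kappa> w i"

definition participants_pmf :: "nat \<Rightarrow> (nat \<Rightarrow> real) \<Rightarrow> real \<Rightarrow> nat set pmf" where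
  "participants_pmf N w \<kappa> =
     map_pmf (\<lambda>b. {i \<in> {1..N}. b i})
       (Pi_pmf {1..N} False (\<lambda>i. bernoulli_pmf (send_prob \<kappa> w i)))"

(* Only elements outside S are candidates, so that every round enlarges S. *)
definition candidates :: "'e set \<Rightarrow> 'e set set \<Rightarrow> 'e set \<Rightarrow> 'e set" where
  "candidates E I S = {e \<in> E - S. insert e S \<in> I}"

definition server_update ::
  "'e set \<Rightarrow> 'e set set \<Rightarrow> (('e \<Rightarrow> real) \<Rightarrow> 'e set \<Rightarrow> 'e) \<Rightarrow> (nat \<Rightarrow> 'e set \<Rightarrow> real)
     \<Rightarrow> (nat \<Rightarrow> real) \<Rightarrow> real \<Rightarrow> 'e set \<Rightarrow> nat set \<Rightarrow> 'e set" where
  "server_update E I sel f w \<kappa> S P =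
     insert (sel (\<lambda>e. \<Sum>i\<in>P. client_vector f w \<kappa> S i e) (candidates E I S)) S"

(* Joint law, after the given number of rounds, of the current set S and of the list whose
   entry t is the set of clients that sent their vector in round t. *)
primrec fed_discrete_greedy ::
  "'e set \<Rightarrow> 'e set set \<Rightarrow> (('e \<Rightarrow> real) \<Rightarrow> 'e set \<Rightarrow> 'e) \<Rightarrow> nat \<Rightarrow> (nat \<Rightarrow> 'e set \<Rightarrow> real)
     \<Rightarrow> (nat \<Rightarrow> real) \<Rightarrow> real \<Rightarrow> nat \<Rightarrow> ('e set \<times> nat set list) pmf" where
  "fed_discrete_greedy E I sel N f w \<kappa> 0 = return_pmf ({}, [])"
| "fed_discrete_greedy E I sel N f w \<kappa> (Suc t) =
     bind_pmf (fed_discrete_greedy E I sel N f w \<kappa> t) (\<lambda>(S, h).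
       map_pmf (\<lambda>P. (server_update E I sel f w \<kappa> S P, h @ [P])) (participants_pmf N w \<kappa>))"

definition cov :: "(nat \<Rightarrow> nat set) \<Rightarrow> nat \<Rightarrow> nat set \<Rightarrow> real" where
  "cov G i A = (if \<exists>a\<in>A. i \<in> G a then 1 else 0)"

definition cov_total :: "nat \<Rightarrow> (nat \<Rightarrow> nat set) \<Rightarrow> nat set \<Rightarrow> real" where
  "cov_total N G A = (\<Sum>i=1..N. cov G i A)"

definition cov_OPT :: "nat \<Rightarrow> nat \<Rightarrow> (nat \<Rightarrow> nat set) \<Rightarrow> nat \<Rightarrow> real" where
  "cov_OPT n N G k = Max (cov_total N G ` {A. A \<subseteq> {1..n} \<and> card A \<le> k})"

(* A client that belongs to no group (empty maximum) gets importance factor 0. *)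
definition importance :: "nat \<Rightarrow> (nat \<Rightarrow> nat set) \<Rightarrow> nat \<Rightarrow> real" where
  "importance n G i =
     (if \<exists>a\<in>{1..n}. i \<in> G a
      then Max {1 / real (card (G a)) | a. a \<in> {1..n} \<and> i \<in> G a} else 0)"

definition cov_params :: "(nat \<times> nat \<times> real) set" where
  "cov_params = {(k, n, \<epsilon>). 1 \<le> k \<and> k \<le> n \<and> 0 < \<epsilon> \<and> \<epsilon> < 1}"

end

theory Submission
  imports Defs
begin

text \<open>
  Given the current set, the aggregated vector is at each group an unbiased estimate of the true
  marginal gain. The choice of importance factors bounds every random summand by
  \<open>OPT / \<kappa>\<close>, since a client that group \<open>G a\<close> newly covers sends with probability at least
  \<open>min (\<kappa> / |G a|) 1\<close> and \<open>|G a| \<le> OPT\<close>. Hence the variance is at most \<open>OPT\<^sup>2 / \<kappa>\<close>, and a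
  Chernoff argument keeps all estimates of all \<open>k\<close> rounds within \<open>\<delta> = \<epsilon> OPT / (2 k)\<close> with
  probability at least \<open>1 - 1/n\<close> once \<open>\<kappa> \<ge> 16 k\<^sup>2 ln (2 n\<^sup>3) / \<epsilon>\<^sup>2\<close>, and \<open>k\<^sup>2 \<le> k n\<close>. On this
  event each round loses at most \<open>2 \<delta>\<close> against exact greedy, so that
  \<open>OPT - F S\<^sub>t \<le> (1 - 1/k)^t OPT + 2 t \<delta>\<close>. The number of participants is controlled by
  \<open>\<Sum>i. w i \<le> \<Sum>a. |G a| / |G a| \<le> n\<close>.
\<close>

section \<open>Exponential tail bounds for inverse-probability sampling, and composition of failure
  probabilities\<close>

text \<open>For negative \<open>x = - y\<close>, the quadratic Taylor lower bound on
  \<open>exp y\<close> is inverted; multiplying it by \<open>1 - y + y\<^sup>2\<close> cancels the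
  linear term and leaves only nonnegative excess over 1.\<close>

lemma exp_le_quadratic:
  fixes x :: real
  assumes "\<bar>x\<bar> \<le> 1"
  shows "exp x \<le> 1 + x + x\<^sup>2"
proof (cases "0 \<le> x")
  case True
  then show ?thesis using assms exp_bound by auto
next
  case False
  define y where "y = - x"
  have y: "0 \<le> y" using False by (simp add: y_def)
  have "1 + y + y\<^sup>2 / 2 \<le> exp y" using exp_lower_Taylor_quadratic[OF y] .
  moreover have pos: "0 < 1 + y + y\<^sup>2 / 2" using y by (simp add: add_pos_nonneg)
  ultimately have "exp (- y) \<le> 1 / (1 + y + y\<^sup>2 / 2)"
    by (simp add: exp_minus inverse_eq_divide frac_le)
  also have "\<dots> \<le> 1 - y + y\<^sup>2"
  proof -
    have "(1 - y + y\<^sup>2) * (1 + y + y\<^sup>2 / 2) = 1 + y\<^sup>2 / 2 + y ^ 3 / 2 + y ^ 4 / 2"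
      by (simp add: field_simps power2_eq_square power3_eq_cube power4_eq_xxxx)
    also have "\<dots> \<ge> 1" using y by simp
    finally show ?thesis using pos by (simp add: divide_le_eq)
  qed
  finally show ?thesis by (simp add: y_def)
qed

text \<open>
  Coordinates with \<open>p i = 1\<close> are deterministic, so they are exempt from the bound \<open>R\<close> on the
  size of the summands.
\<close>

lemma inverse_sampling_mgf:
  fixes p :: "'a \<Rightarrow> real"
  assumes A: "finite A" "U \<subseteq> A"
    and p: "\<And>i. i \<in> U \<Longrightarrow> 0 < p i" "\<And>i. i \<in> U \<Longrightarrow> p i \<le> 1"
    and R: "0 \<le> R" "\<And>i. i \<in> U \<Longrightarrow> p i = 1 \<or> 1 / p i \<le> R"
    and l: "\<bar>l\<bar> * R \<le> 1"
  shows "measure_pmf.expectation (Pi_pmf A d (\<lambda>i. bernoulli_pmf (p i)))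
      (\<lambda>b. exp (l * ((\<Sum>i\<in>U. of_bool (b i) / p i) - real (card U)))) \<le> exp (l\<^sup>2 * (real (card U) * R))"
proof -
  \<comment> \<open>The value 1 outside \<open>U\<close> lets the product run over all of
    \<open>A\<close>, the index set on which the coordinates are independent.\<close>
  define g where "g = (\<lambda>i (v::bool). if i \<in> U then exp (l * (of_bool v / p i - 1)) else 1)"
  have fU: "finite U" using A finite_subset by blast
  have "(\<Prod>i\<in>A. g i (b i)) = exp (l * ((\<Sum>i\<in>U. of_bool (b i) / p i) - real (card U)))" for b
  proof -
    have "(\<Prod>i\<in>A. g i (b i)) = (\<Prod>i\<in>U. g i (b i))"
      using A by (intro prod.mono_neutral_right) (auto simp: g_def)
    also have "\<dots> = exp (\<Sum>i\<in>U. l * (of_bool (b i) / p i - 1))"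
      using fU by (simp add: g_def exp_sum)
    finally show ?thesis by (simp add: sum_distrib_left[symmetric] sum_subtractf)
  qed
  then have "measure_pmf.expectation (Pi_pmf A d (\<lambda>i. bernoulli_pmf (p i)))
      (\<lambda>b. exp (l * ((\<Sum>i\<in>U. of_bool (b i) / p i) - real (card U))))
    = measure_pmf.expectation (Pi_pmf A d (\<lambda>i. bernoulli_pmf (p i))) (\<lambda>b. \<Prod>i\<in>A. g i (b i))"
    by simp
  also have "\<dots> = (\<Prod>i\<in>A. measure_pmf.expectation (bernoulli_pmf (p i)) (g i))"
    using A(1) by (intro expectation_prod_Pi_pmf integrable_measure_pmf_finite)
      (auto simp: g_def intro: finite_subset[OF subset_UNIV])
  also have "\<dots> = (\<Prod>i\<in>U. measure_pmf.expectation (bernoulli_pmf (p i)) (g i))"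
    using A by (intro prod.mono_neutral_right) (auto simp: g_def)
  also have "\<dots> \<le> (\<Prod>i\<in>U. exp (l\<^sup>2 * R))"
  proof (intro prod_mono conjI)
    fix i assume i: "i \<in> U"
    show "0 \<le> measure_pmf.expectation (bernoulli_pmf (p i)) (g i)"
      by (intro integral_nonneg_AE) (simp add: g_def)
    have e: "measure_pmf.expectation (bernoulli_pmf (p i)) (g i)
        = exp (l * (1 / p i - 1)) * p i + exp (- l) * (1 - p i)"
      using p[OF i] i by (simp add: g_def)
    show "measure_pmf.expectation (bernoulli_pmf (p i)) (g i) \<le> exp (l\<^sup>2 * R)"
    proof (cases "p i = 1")
      case True
      then show ?thesis using e R by simp
    next
      case False
      define x where "x = l / p i"
      have pi: "0 < p i" "1 / p i \<le> R" using p[OF i] R(2)[OF i] False by auto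
      have "\<bar>x\<bar> = \<bar>l\<bar> * (1 / p i)" using pi by (simp add: x_def)
      also have "\<dots> \<le> \<bar>l\<bar> * R" using pi by (intro mult_left_mono) auto
      finally have "\<bar>x\<bar> \<le> 1" using l by simp
      then have ex: "exp x \<le> 1 + x + x\<^sup>2" by (rule exp_le_quadratic)
      \<comment> \<open>Taking out \<open>exp (- l)\<close> isolates the centering: the linear term
        of the quadratic bound becomes exactly \<open>l\<close> and cancels against it, while the
        quadratic term becomes \<open>l\<^sup>2 / p i\<close>, at most
        \<open>l\<^sup>2 * R\<close>.\<close>
      have "exp (l * (1 / p i - 1)) = exp x * exp (- l)"
        by (simp add: x_def exp_add[symmetric] algebra_simps)
      then have "measure_pmf.expectation (bernoulli_pmf (p i)) (g i)
          = exp (- l) * (1 + (exp x - 1) * p i)"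
        unfolding e by (simp add: algebra_simps)
      also have "\<dots> \<le> exp (- l) * (1 + (x + x\<^sup>2) * p i)"
        using ex pi by (intro mult_left_mono add_left_mono mult_right_mono) auto
      also have "(x + x\<^sup>2) * p i = l + l\<^sup>2 * (1 / p i)"
        using pi by (simp add: x_def field_simps power2_eq_square)
      also have "exp (- l) * (1 + (l + l\<^sup>2 * (1 / p i))) \<le> exp (- l) * (1 + (l + l\<^sup>2 * R))"
        using pi by (intro mult_left_mono add_left_mono) auto
      also have "\<dots> \<le> exp (- l) * exp (l + l\<^sup>2 * R)"
        by (intro mult_left_mono exp_ge_add_one_self) auto
      also have "\<dots> = exp (l\<^sup>2 * R)" by (simp add: exp_add[symmetric])
      finally show ?thesis .
    qed
  qed
  also have "\<dots> = exp (l\<^sup>2 * (real (card U) * R))"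
    by (simp add: exp_of_nat_mult[symmetric] algebra_simps)
  finally show ?thesis .
qed

lemma finite_set_Pi_bernoulli:
  "finite A \<Longrightarrow> finite (set_pmf (Pi_pmf A d (\<lambda>i. bernoulli_pmf (p i))))"
  by (intro finite_subset[OF set_Pi_pmf_subset'] finite_PiE_dflt)
    (auto intro: finite_subset[OF subset_UNIV])

text \<open>Markov's inequality for the exponential moments of both signs. \<open>V\<close>
  dominates the variance proxy \<open>card U * R\<close>, and
  \<open>\<delta> * R \<le> 2 * V\<close> says precisely that the chosen exponent stays in the range
  of the moment bound.\<close>

lemma inverse_sampling_tail:
  fixes p :: "'a \<Rightarrow> real"
  assumes A: "finite A" "U \<subseteq> A"
    and p: "\<And>i. i \<in> U \<Longrightarrow> 0 < p i" "\<And>i. i \<in> U \<Longrightarrow> p i \<le> 1"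
    and R: "0 \<le> R" "\<And>i. i \<in> U \<Longrightarrow> p i = 1 \<or> 1 / p i \<le> R"
    and V: "0 < V" "real (card U) * R \<le> V"
    and \<delta>: "0 \<le> \<delta>" "\<delta> * R \<le> 2 * V"
  shows "measure_pmf.prob (Pi_pmf A d (\<lambda>i. bernoulli_pmf (p i)))
      {b. \<delta> \<le> \<bar>(\<Sum>i\<in>U. of_bool (b i) / p i) - real (card U)\<bar>} \<le> 2 * exp (- \<delta>\<^sup>2 / (4 * V))"
proof -
  let ?P = "Pi_pmf A d (\<lambda>i. bernoulli_pmf (p i))"
  define D where "D = (\<lambda>b. (\<Sum>i\<in>U. of_bool (b i) / p i) - real (card U))"
  \<comment> \<open>This value minimises \<open>l\<^sup>2 * V - l * \<delta>\<close>, with minimum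
    \<open>- \<delta>\<^sup>2 / (4 * V)\<close>.\<close>
  define l where "l = \<delta> / (2 * V)"
  have l: "0 \<le> l" "l * R \<le> 1" using V \<delta> by (simp_all add: l_def divide_le_eq mult.commute)
  \<comment> \<open>Used with \<open>c = l\<close> and \<open>c = - l\<close> for the two tails.
    Keeping the factor \<open>l\<close> inside the event avoids dividing by it, so
    \<open>\<delta> = 0\<close> is covered too.\<close>
  have one_sided: "measure_pmf.prob ?P {b. l * \<delta> \<le> c * D b} \<le> exp (- \<delta>\<^sup>2 / (4 * V))"
    if c: "\<bar>c\<bar> = l" for c
  proof -
    have "measure_pmf.prob ?P {b. l * \<delta> \<le> c * D b} =
        measure_pmf.prob ?P {b \<in> space ?P. exp (l * \<delta>) \<le> exp (c * D b)}"
      by simp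
    also have "\<dots> \<le> measure_pmf.expectation ?P (\<lambda>b. exp (c * D b)) / exp (l * \<delta>)"
      by (rule integral_Markov_inequality_measure[where A = "{}"])
        (auto intro!: integrable_measure_pmf_finite finite_set_Pi_bernoulli A)
    also have "\<dots> \<le> exp (c\<^sup>2 * (real (card U) * R)) / exp (l * \<delta>)"
      unfolding D_def using inverse_sampling_mgf[OF A p R, where l = c] c l
      by (intro divide_right_mono) auto
    also have "\<dots> \<le> exp (l\<^sup>2 * V) / exp (l * \<delta>)"
      using V c by (intro divide_right_mono) (auto intro!: mult_left_mono simp flip: c)
    also have "\<dots> = exp (- \<delta>\<^sup>2 / (4 * V))"
      using V by (simp add: exp_diff[symmetric] l_def power2_eq_square field_simps)
    finally show ?thesis .
  qed
  have "l * \<delta> \<le> l * D b \<or> l * \<delta> \<le> (- l) * D b" if "\<delta> \<le> \<bar>D b\<bar>" for b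
  proof (cases "0 \<le> D b")
    case True
    then show ?thesis using that l by (intro disjI1 mult_left_mono) auto
  next
    case False
    then have "l * \<delta> \<le> l * (- D b)" using that l by (intro mult_left_mono) auto
    then show ?thesis by simp
  qed
  then have "measure_pmf.prob ?P {b. \<delta> \<le> \<bar>D b\<bar>} \<le>
      measure_pmf.prob ?P ({b. l * \<delta> \<le> l * D b} \<union> {b. l * \<delta> \<le> (- l) * D b})"
    by (intro measure_pmf.finite_measure_mono) auto
  also have "\<dots> \<le> measure_pmf.prob ?P {b. l * \<delta> \<le> l * D b} + measure_pmf.prob ?P {b. l * \<delta> \<le> (- l) * D b}"
    by (rule measure_subadditive) auto
  also have "\<dots> \<le> exp (- \<delta>\<^sup>2 / (4 * V)) + exp (- \<delta>\<^sup>2 / (4 * V))"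
    using one_sided[of l] one_sided[of "- l"] l by (intro add_mono) auto
  finally show ?thesis unfolding D_def by simp
qed

text \<open>A union bound for a two-stage experiment: either the first stage misses
  \<open>Q\<close>, or the second stage fails from a good state. Restricting the last hypothesis to
  the support lets invariants of reachable states enter.\<close>

lemma prob_bind_pmf_failure:
  assumes "measure_pmf.prob p {x. \<not> Q x} \<le> a" "0 \<le> b"
    and "\<And>x. x \<in> set_pmf p \<Longrightarrow> Q x \<Longrightarrow> measure_pmf.prob (f x) B \<le> b"
  shows "measure_pmf.prob (bind_pmf p f) B \<le> a + b"
proof -
  have a: "0 \<le> a" using assms(1) measure_nonneg order_trans by blast
  have "emeasure (bind_pmf p f) B = (\<integral>\<^sup>+x. emeasure (f x) B \<partial>p)" by simp
  also have "\<dots> \<le> (\<integral>\<^sup>+x. indicator {x. \<not> Q x} x + ennreal b \<partial>p)"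
  proof (intro nn_integral_mono_AE, unfold AE_measure_pmf_iff, intro ballI)
    fix x assume x: "x \<in> set_pmf p"
    show "emeasure (f x) B \<le> indicator {x. \<not> Q x} x + ennreal b"
    proof (cases "Q x")
      case True
      then show ?thesis using assms(3)[OF x] by (simp add: measure_pmf.emeasure_eq_measure ennreal_leI)
    next
      case False
      have "emeasure (f x) B \<le> 1" by (rule measure_pmf.emeasure_le_1)
      also have "\<dots> \<le> 1 + ennreal b" by simp
      finally show ?thesis using False by simp
    qed
  qed
  also have "\<dots> = ennreal (measure_pmf.prob p {x. \<not> Q x} + b)"
    using assms(2) by (simp add: nn_integral_add measure_pmf.emeasure_eq_measure)
  also have "\<dots> \<le> ennreal (a + b)" using assms(1) by (intro ennreal_leI) simp
  finally show ?thesis using a assms(2)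
    by (simp add: measure_pmf.emeasure_eq_measure del: ennreal_plus)
qed


section \<open>Marginal gains of the coverage function and its optimum\<close>

text \<open>The marginal gain is kept as a set of clients because its cardinality is the true gain
  and inverse-probability sampling of the same set gives the server's estimate.\<close>

definition newly_covered :: "nat \<Rightarrow> (nat \<Rightarrow> nat set) \<Rightarrow> nat set \<Rightarrow> nat \<Rightarrow> nat set" where
  "newly_covered N G S e = {i \<in> {1..N}. i \<in> G e \<and> (\<forall>a\<in>S. i \<notin> G a)}"

lemma finite_newly_covered [simp]: "finite (newly_covered N G S e)"
  by (simp add: newly_covered_def)

lemma card_newly_covered:
  "real (card (newly_covered N G S e)) = (\<Sum>i=1..N. of_bool (i \<in> newly_covered N G S e))"
proof -
  have "{1..N} \<inter> {i. i \<in> newly_covered N G S e} = newly_covered N G S e"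
    by (auto simp: newly_covered_def)
  then show ?thesis by (simp add: sum.If_cases of_bool_def)
qed

lemma cov_insert_diff:
  "i \<in> {1..N} \<Longrightarrow> cov G i (insert e S) - cov G i S = of_bool (i \<in> newly_covered N G S e)"
  by (auto simp: cov_def newly_covered_def)

lemma cov_total_insert:
  "cov_total N G (insert e S) = cov_total N G S + real (card (newly_covered N G S e))"
proof -
  have "cov_total N G (insert e S) - cov_total N G S
      = (\<Sum>i=1..N. cov G i (insert e S) - cov G i S)"
    by (simp add: cov_total_def sum_subtractf)
  also have "\<dots> = real (card (newly_covered N G S e))"
    unfolding card_newly_covered by (intro sum.cong refl cov_insert_diff)
  finally show ?thesis by simp
qed

lemma cov_total_nonneg: "0 \<le> cov_total N G S"
  unfolding cov_total_def by (intro sum_nonneg) (simp add: cov_def)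

lemma cov_total_empty [simp]: "cov_total N G {} = 0"
  by (simp add: cov_total_def cov_def)

lemma cov_total_singleton: "G a \<subseteq> {1..N} \<Longrightarrow> cov_total N G {a} = real (card (G a))"
proof -
  assume "G a \<subseteq> {1..N}"
  then have "newly_covered N G {} a = G a" by (auto simp: newly_covered_def)
  then show ?thesis using cov_total_insert[of N G a "{}"] by simp
qed

text \<open>This is the form of submodularity that greedy needs: a client covered by
  \<open>A\<close> but not by \<open>S\<close> is newly covered by some group of
  \<open>A - S\<close>, so the sum counts it at least once.\<close>

lemma cov_total_le_sum_newly_covered:
  assumes "finite A"
  shows "cov_total N G A \<le> cov_total N G S + (\<Sum>a\<in>A - S. real (card (newly_covered N G S a)))"
proof -
  have "cov G i A \<le> cov G i S + (\<Sum>a\<in>A - S. of_bool (i \<in> newly_covered N G S a))"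
    if i: "i \<in> {1..N}" for i
  proof (cases "cov G i A = 1 \<and> cov G i S = 0")
    case True
    then obtain a where a: "a \<in> A" "i \<in> G a" "\<forall>a\<in>S. i \<notin> G a"
      by (auto simp: cov_def split: if_splits)
    then have "a \<in> A - S" "i \<in> newly_covered N G S a" using i by (auto simp: newly_covered_def)
    then have "(1::real) \<le> (\<Sum>a\<in>A - S. of_bool (i \<in> newly_covered N G S a))"
      using member_le_sum[of a "A - S" "\<lambda>a. of_bool (i \<in> newly_covered N G S a) :: real"] assms
      by simp
    then show ?thesis using True by simp
  next
    case False
    then have "cov G i A \<le> cov G i S" by (auto simp: cov_def split: if_splits)
    then show ?thesis by (simp add: add_increasing2 sum_nonneg)
  qed
  then have "cov_total N G A \<le>
      (\<Sum>i=1..N. cov G i S + (\<Sum>a\<in>A - S. of_bool (i \<in> newly_covered N G S a)))"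
    unfolding cov_total_def by (rule sum_mono)
  also have "\<dots> = cov_total N G S + (\<Sum>a\<in>A - S. real (card (newly_covered N G S a)))"
    unfolding cov_total_def card_newly_covered sum.distrib by (subst sum.swap) simp
  finally show ?thesis .
qed

lemma finite_feasible: "finite {A. A \<subseteq> {1..n::nat} \<and> card A \<le> k}"
  by (rule finite_subset[of _ "Pow {1..n}"]) auto

lemma cov_total_le_OPT: "A \<subseteq> {1..n} \<Longrightarrow> card A \<le> k \<Longrightarrow> cov_total N G A \<le> cov_OPT n N G k"
  unfolding cov_OPT_def using finite_feasible by (intro Max_ge) auto

lemma cov_OPT_attained:
  obtains A where "A \<subseteq> {1..n}" "card A \<le> k" "cov_OPT n N G k = cov_total N G A"
proof -
  have "cov_OPT n N G k \<in> cov_total N G ` {A. A \<subseteq> {1..n} \<and> card A \<le> k}"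
    unfolding cov_OPT_def using finite_feasible by (intro Max_in) (auto intro!: exI[of _ "{}"])
  then show ?thesis using that by blast
qed

lemma cov_OPT_nonneg: "0 \<le> cov_OPT n N G k"
  using cov_total_le_OPT[of "{}" n k N G] by simp

section \<open>Importance factors and their total\<close>

lemma finite_importance_set: "finite {1 / real (card (G a)) | a. a \<in> {1..n::nat} \<and> i \<in> G a}"
  by (rule finite_subset[of _ "(\<lambda>a. 1 / real (card (G a))) ` {1..n}"]) auto

lemma importance_ge:
  "a \<in> {1..n} \<Longrightarrow> i \<in> G a \<Longrightarrow> 1 / real (card (G a)) \<le> importance n G i"
  unfolding importance_def using finite_importance_set[of G n i] by (auto intro!: Max_ge)

lemma importance_nonneg: "0 \<le> importance n G i"
proof (cases "\<exists>a\<in>{1..n}. i \<in> G a")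
  case True
  then obtain a where a: "a \<in> {1..n}" "i \<in> G a" by blast
  have "0 \<le> 1 / real (card (G a))" by simp
  then show ?thesis using importance_ge[of a n i G] a by linarith
qed (auto simp: importance_def)

lemma importance_le_sum:
  "importance n G i \<le> (\<Sum>a=1..n. of_bool (i \<in> G a) / real (card (G a)))"
proof (cases "\<exists>a\<in>{1..n}. i \<in> G a")
  case True
  have "Max {1 / real (card (G a)) | a. a \<in> {1..n} \<and> i \<in> G a}
      \<in> {1 / real (card (G a)) | a. a \<in> {1..n} \<and> i \<in> G a}"
    using True finite_importance_set by (intro Max_in) auto
  then obtain a where a: "a \<in> {1..n}" "i \<in> G a" "importance n G i = 1 / real (card (G a))"
    using True unfolding importance_def by auto
  then show ?thesis
    using member_le_sum[of a "{1..n}" "\<lambda>a. of_bool (i \<in> G a) / real (card (G a))"] by simp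
qed (auto simp: importance_def intro: sum_nonneg)

text \<open>Double counting: bounding the maximum by a sum over groups and exchanging summations,
  the members of each group contribute at most 1 in total.\<close>

lemma sum_importance_le:
  assumes "\<And>a. a \<in> {1..n} \<Longrightarrow> G a \<subseteq> {1..N}"
  shows "(\<Sum>i=1..N. importance n G i) \<le> real n"
proof -
  have "(\<Sum>i=1..N. importance n G i) \<le> (\<Sum>i=1..N. \<Sum>a=1..n. of_bool (i \<in> G a) / real (card (G a)))"
    by (intro sum_mono importance_le_sum)
  also have "\<dots> = (\<Sum>a=1..n. (\<Sum>i=1..N. of_bool (i \<in> G a)) / real (card (G a)))"
    unfolding sum_divide_distrib by (rule sum.swap)
  also have "\<dots> = (\<Sum>a=1..n. real (card (G a)) / real (card (G a)))"
  proof (intro sum.cong refl arg_cong2[of _ _ _ _ "(/)"])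
    fix a assume "a \<in> {1..n}"
    then have "{1..N} \<inter> {i. i \<in> G a} = G a" using assms by auto
    then show "(\<Sum>i=1..N. of_bool (i \<in> G a)) = real (card (G a))"
      by (simp add: sum.If_cases of_bool_def)
  qed
  \<comment> \<open>Only an inequality, since an empty group contributes
    \<open>0 / 0 = 0\<close>.\<close>
  also have "\<dots> \<le> (\<Sum>a=1..n. 1)" by (intro sum_mono) simp
  finally show ?thesis by simp
qed

section \<open>One communication round\<close>

text \<open>The tail bound is applied with \<open>R = B / \<kappa>\<close> and
  \<open>V = B\<^sup>2 / \<kappa>\<close>, followed by a union bound over the \<open>n\<close>
  groups. \<open>B\<close> will be the optimum, and \<open>S\<close> is fixed because the senders
  are drawn afresh in each round.\<close>

lemma participants_round_failure:
  assumes G: "\<And>a. a \<in> {1..n} \<Longrightarrow> G a \<subseteq> {1..N}"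
    and B: "0 < B" "\<And>a. a \<in> {1..n} \<Longrightarrow> real (card (G a)) \<le> B"
    and \<kappa>: "0 < \<kappa>" and \<delta>: "0 \<le> \<delta>" "\<delta> \<le> 2 * B"
  shows "measure_pmf.prob (participants_pmf N (importance n G) \<kappa>)
      {P. \<exists>e\<in>{1..n}. \<delta> \<le> \<bar>(\<Sum>i\<in>P. client_vector (cov G) (importance n G) \<kappa> S i e)
                              - real (card (newly_covered N G S e))\<bar>}
    \<le> real n * (2 * exp (- \<delta>\<^sup>2 * \<kappa> / (4 * B\<^sup>2)))"
proof -
  define p where "p = send_prob \<kappa> (importance n G)"
  let ?Q = "Pi_pmf {1..N} False (\<lambda>i. bernoulli_pmf (p i))"
  define bad where "bad = (\<lambda>e. {b. \<delta> \<le> \<bar>(\<Sum>i\<in>newly_covered N G S e. of_bool (b i) / p i)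
      - real (card (newly_covered N G S e))\<bar>})"
  \<comment> \<open>A client outside \<open>newly_covered N G S e\<close> has coordinate 0, so the
    aggregate is an inverse-probability sum over that set alone.\<close>
  have vec: "(\<Sum>i | i \<in> {1..N} \<and> b i. client_vector (cov G) (importance n G) \<kappa> S i e)
      = (\<Sum>i\<in>newly_covered N G S e. of_bool (b i) / p i)" for b e
  proof -
    have "(\<Sum>i | i \<in> {1..N} \<and> b i. client_vector (cov G) (importance n G) \<kappa> S i e)
        = (\<Sum>i | i \<in> {1..N} \<and> b i. of_bool (i \<in> newly_covered N G S e) / p i)"
      unfolding client_vector_def p_def
      by (intro sum.cong refl arg_cong2[of _ _ _ _ "(/)"] cov_insert_diff) auto
    also have "\<dots> = (\<Sum>i=1..N. of_bool (b i) * of_bool (i \<in> newly_covered N G S e) / p i)"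
      by (intro sum.mono_neutral_cong_left) auto
    also have "\<dots> = (\<Sum>i\<in>newly_covered N G S e. of_bool (b i) / p i)"
      by (intro sum.mono_neutral_cong_right) (auto simp: newly_covered_def)
    finally show ?thesis .
  qed
  have tail: "measure_pmf.prob ?Q (bad e) \<le> 2 * exp (- \<delta>\<^sup>2 * \<kappa> / (4 * B\<^sup>2))" if e: "e \<in> {1..n}" for e
  proof -
    let ?U = "newly_covered N G S e"
    have fin: "finite (G e)" using G[OF e] finite_subset by blast
    have U: "?U \<subseteq> G e" by (auto simp: newly_covered_def)
    have cU: "real (card ?U) \<le> B" using card_mono[OF fin U] B(2)[OF e] by linarith
    have w: "0 < real (card (G e))" "1 / real (card (G e)) \<le> importance n G i" if "i \<in> ?U" for i
      using that U fin e importance_ge[of e n i G] by (auto simp: card_gt_0_iff)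
    have wpos: "0 < importance n G i" if "i \<in> ?U" for i
      using w[OF that] by (meson divide_pos_pos less_le_trans zero_less_one)
    \<comment> \<open>Without truncation \<open>1 / p i = 1 / (\<kappa> * w i)\<close>, and
      \<open>w i \<ge> 1 / card (G e)\<close> turns this into at most
      \<open>card (G e) / \<kappa>\<close>, where \<open>w\<close> is the importance factor; with
      truncation \<open>p i = 1\<close>.\<close>
    have inv: "p i = 1 \<or> 1 / p i \<le> B / \<kappa>" if i: "i \<in> ?U" for i
    proof (cases "\<kappa> * importance n G i < 1")
      case True
      have "1 / importance n G i \<le> real (card (G e))"
        using w[OF i] wpos[OF i] by (simp add: field_simps)
      also have "\<dots> \<le> B" by (rule B(2)[OF e])
      finally have "1 / importance n G i / \<kappa> \<le> B / \<kappa>" using \<kappa> by (intro divide_right_mono) auto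
      then show ?thesis using True by (simp add: p_def send_prob_def mult.commute)
    qed (simp add: p_def send_prob_def)
    have "measure_pmf.prob ?Q (bad e) \<le> 2 * exp (- \<delta>\<^sup>2 / (4 * (B\<^sup>2 / \<kappa>)))"
      unfolding bad_def
    proof (rule inverse_sampling_tail[where R = "B / \<kappa>"])
      show "?U \<subseteq> {1..N}" by (auto simp: newly_covered_def)
      show "real (card ?U) * (B / \<kappa>) \<le> B\<^sup>2 / \<kappa>"
        using cU B \<kappa> by (simp add: power2_eq_square divide_right_mono mult_right_mono)
      show "\<delta> * (B / \<kappa>) \<le> 2 * (B\<^sup>2 / \<kappa>)"
        using \<delta> B \<kappa> mult_right_mono[of \<delta> "2 * B" "B / \<kappa>"] by (simp add: power2_eq_square)
      show "0 < p i" if "i \<in> ?U" for i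
        using wpos[OF that] \<kappa> by (simp add: p_def send_prob_def)
    qed (use B \<kappa> \<delta> inv in \<open>auto simp: p_def send_prob_def\<close>)
    then show ?thesis by simp
  qed
  have "measure_pmf.prob (participants_pmf N (importance n G) \<kappa>)
      {P. \<exists>e\<in>{1..n}. \<delta> \<le> \<bar>(\<Sum>i\<in>P. client_vector (cov G) (importance n G) \<kappa> S i e)
                              - real (card (newly_covered N G S e))\<bar>}
      = measure_pmf.prob ?Q (\<Union>e\<in>{1..n}. bad e)"
    unfolding participants_pmf_def p_def[symmetric] measure_map_pmf
    by (rule arg_cong[of _ _ "measure_pmf.prob ?Q"]) (simp add: bad_def vec[simplified] set_eq_iff)
  also have "\<dots> \<le> (\<Sum>e=1..n. measure_pmf.prob ?Q (bad e))"
    by (rule measure_pmf.finite_measure_subadditive_finite) auto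
  also have "\<dots> \<le> (\<Sum>e=1..n. 2 * exp (- \<delta>\<^sup>2 * \<kappa> / (4 * B\<^sup>2)))"
    by (intro sum_mono tail)
  finally show ?thesis by simp
qed

text \<open>By linearity the expectation is the sum of the sending probabilities, each at most
  \<open>\<kappa>\<close> times the importance factor.\<close>

lemma expected_participants_le:
  assumes G: "\<And>a. a \<in> {1..n} \<Longrightarrow> G a \<subseteq> {1..N}" and \<kappa>: "0 \<le> \<kappa>"
  shows "measure_pmf.expectation (participants_pmf N (importance n G) \<kappa>) (\<lambda>P. real (card P))
    \<le> \<kappa> * real n"
proof -
  define p where "p = send_prob \<kappa> (importance n G)"
  have p: "0 \<le> p i" "p i \<le> 1" "p i \<le> \<kappa> * importance n G i" for i
    using \<kappa> importance_nonneg by (auto simp: p_def send_prob_def)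
  let ?Q = "Pi_pmf {1..N} False (\<lambda>i. bernoulli_pmf (p i))"
  have card_eq: "real (card {i \<in> {1..N}. b i}) = (\<Sum>i=1..N. of_bool (b i))" for b
    by (simp add: sum.If_cases of_bool_def Int_def)
  have "measure_pmf.expectation (participants_pmf N (importance n G) \<kappa>) (\<lambda>P. real (card P))
      = measure_pmf.expectation ?Q (\<lambda>b. \<Sum>i=1..N. of_bool (b i))"
    by (simp only: participants_pmf_def p_def[symmetric] integral_map_pmf card_eq)
  also have "\<dots> = (\<Sum>i=1..N. measure_pmf.expectation ?Q (\<lambda>b. of_bool (b i)))"
    by (intro Bochner_Integration.integral_sum integrable_measure_pmf_finite
        finite_set_Pi_bernoulli) auto
  also have "\<dots> = (\<Sum>i=1..N. p i)"
  proof (intro sum.cong refl)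
    fix i assume i: "i \<in> {1..N}"
    have "measure_pmf.expectation ?Q (\<lambda>b. of_bool (b i))
        = measure_pmf.expectation (map_pmf (\<lambda>b. b i) ?Q) (\<lambda>v. of_bool v :: real)"
      by simp
    also have "\<dots> = p i" using i p by (subst Pi_pmf_component) auto
    finally show "measure_pmf.expectation ?Q (\<lambda>b. of_bool (b i)) = p i" .
  qed
  also have "\<dots> \<le> \<kappa> * (\<Sum>i=1..N. importance n G i)"
    unfolding sum_distrib_left by (intro sum_mono p)
  also have "\<dots> \<le> \<kappa> * real n" using sum_importance_le[OF G] \<kappa> by (intro mult_left_mono) auto
  finally show ?thesis .
qed

section \<open>Structure of a run: recorded participants and selected sets\<close>

lemma fed_discrete_greedy_history_length:
  "(S, h) \<in> set_pmf (fed_discrete_greedy E I sel N f w \<kappa> T) \<Longrightarrow> length h = T"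
  by (induction T arbitrary: S h) auto

text \<open>The law of the senders does not depend on the current set, and later rounds only append
  to the history. Expected participation in a run thus reduces to a single round.\<close>

lemma fed_discrete_greedy_history_law:
  "t < T \<Longrightarrow> map_pmf (\<lambda>(S, h). h ! t) (fed_discrete_greedy E I sel N f w \<kappa> T) = participants_pmf N w \<kappa>"
proof (induction T)
  case (Suc T)
  let ?r = "fed_discrete_greedy E I sel N f w \<kappa> T"
  have len: "length (snd x) = T" if "x \<in> set_pmf ?r" for x
    using fed_discrete_greedy_history_length[of "fst x" "snd x"] that by simp
  have "map_pmf (\<lambda>(S, h). h ! t) (fed_discrete_greedy E I sel N f w \<kappa> (Suc T))
      = bind_pmf ?r (\<lambda>x. map_pmf (\<lambda>P. (snd x @ [P]) ! t) (participants_pmf N w \<kappa>))"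
    by (simp add: map_bind_pmf case_prod_beta map_pmf_comp)
  also have "\<dots> = participants_pmf N w \<kappa>"
  \<comment> \<open>The history before this round has length \<open>T\<close>, so index
    \<open>T\<close> reads the new entry and smaller indices read old ones.\<close>
  proof (cases "t = T")
    case True
    have "bind_pmf ?r (\<lambda>x. map_pmf (\<lambda>P. (snd x @ [P]) ! t) (participants_pmf N w \<kappa>))
        = bind_pmf ?r (\<lambda>x. participants_pmf N w \<kappa>)"
      using len True by (intro bind_pmf_cong refl) (simp add: nth_append)
    then show ?thesis by simp
  next
    case False
    then have "bind_pmf ?r (\<lambda>x. map_pmf (\<lambda>P. (snd x @ [P]) ! t) (participants_pmf N w \<kappa>))
        = bind_pmf ?r (\<lambda>x. return_pmf (snd x ! t))"
      using len Suc.prems by (intro bind_pmf_cong refl) (simp add: nth_append)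
    also have "\<dots> = map_pmf (\<lambda>(S, h). h ! t) ?r"
      by (simp add: map_pmf_def case_prod_beta)
    finally show ?thesis using Suc False by simp
  qed
  finally show ?case .
qed simp

lemma candidates_uniform:
  "S \<subseteq> {1..n::nat} \<Longrightarrow> card S < k \<Longrightarrow> candidates {1..n} (uniform_indep {1..n} k) S = {1..n} - S"
  using finite_subset[of S "{1..n}"] by (auto simp: candidates_def uniform_indep_def card_insert_if)

text \<open>\<open>argmax_rule\<close> constrains the choice only on nonempty finite sets;
  \<open>card S < k\<close> with \<open>k \<le> n\<close> supplies a candidate.\<close>

lemma argmax_uniform:
  fixes X :: "nat \<Rightarrow> real"
  assumes "argmax_rule sel" "S \<subseteq> {1..n}" "card S < k" "k \<le> n"
  defines "c \<equiv> sel X (candidates {1..n} (uniform_indep {1..n} k) S)"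
  shows "c \<in> {1..n} - S" and "\<And>e. e \<in> {1..n} - S \<Longrightarrow> X e \<le> X c"
proof -
  have "{1..n} - S \<noteq> {}"
  proof
    assume "{1..n} - S = {}"
    then have "S = {1..n}" using assms(2) by auto
    then show False using assms(3,4) by simp
  qed
  then have "is_arg_max X (\<lambda>e. e \<in> {1..n} - S) c"
    using assms(1) unfolding c_def candidates_uniform[OF assms(2,3)] argmax_rule_def by blast
  then show "c \<in> {1..n} - S" "\<And>e. e \<in> {1..n} - S \<Longrightarrow> X e \<le> X c"
    by (auto simp: is_arg_max_linorder)
qed

text \<open>Each selected element is new, so every round raises the cardinality by exactly
  one.\<close>

lemma fed_discrete_greedy_set:
  assumes "argmax_rule sel" "k \<le> n" "t \<le> k"
    and "(S, h) \<in> set_pmf (fed_discrete_greedy {1..n} (uniform_indep {1..n} k) sel N f w \<kappa> t)"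
  shows "S \<subseteq> {1..n} \<and> card S = t"
  using assms(3,4)
proof (induction t arbitrary: S h)
  case (Suc t)
  then obtain S' h' P where S': "(S', h') \<in> set_pmf
      (fed_discrete_greedy {1..n} (uniform_indep {1..n} k) sel N f w \<kappa> t)"
    and S: "S = server_update {1..n} (uniform_indep {1..n} k) sel f w \<kappa> S' P"
    by auto
  have IH: "S' \<subseteq> {1..n}" "card S' = t" using Suc.IH[OF _ S'] Suc.prems by auto
  then have "finite S'" using finite_subset by blast
  then show ?case
    using argmax_uniform(1)[OF assms(1) IH(1) _ assms(2)] IH Suc.prems(1)
    by (auto simp: S server_update_def)
qed simp

section \<open>Approximate greedy and accumulation of errors\<close>

text \<open>The chosen gain is within \<open>2 * \<delta>\<close> of the best one, and the best is
  at least the average over an optimal set of at most \<open>k\<close> groups, whose gains sum to at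
  least the remaining gap.\<close>

lemma greedy_step:
  assumes "argmax_rule sel" "S \<subseteq> {1..n}" "card S < k" "k \<le> n"
    and X: "\<And>e. e \<in> {1..n} \<Longrightarrow> \<bar>X e - real (card (newly_covered N G S e))\<bar> < \<delta>"
  defines "c \<equiv> sel X (candidates {1..n} (uniform_indep {1..n} k) S)"
  shows "cov_OPT n N G k - cov_total N G (insert c S)
    \<le> (1 - 1 / real k) * (cov_OPT n N G k - cov_total N G S) + 2 * \<delta>"
proof -
  define m where "m = (\<lambda>e. real (card (newly_covered N G S e)))"
  have k: "0 < k" using assms(3) by simp
  note c = argmax_uniform[OF assms(1-4), where X = X, folded c_def]
  \<comment> \<open>One \<open>\<delta>\<close> pays for underestimating \<open>a\<close>, the other
    for overestimating \<open>c\<close>.\<close>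
  have le: "m a \<le> m c + 2 * \<delta>" if "a \<in> {1..n} - S" for a
    using X[of a] X[of c] c(1) c(2)[OF that] that unfolding m_def by auto
  \<comment> \<open>Nonnegativity allows \<open>card (A - S)\<close>, which may be smaller than
    \<open>k\<close>, to be replaced by \<open>k\<close>.\<close>
  have nn: "0 \<le> m c + 2 * \<delta>" using le[OF c(1)] X[of c] c(1) by (auto simp: m_def)
  obtain A where A: "A \<subseteq> {1..n}" "card A \<le> k" "cov_OPT n N G k = cov_total N G A"
    by (rule cov_OPT_attained)
  have fA: "finite A" using A(1) finite_subset by blast
  have "cov_OPT n N G k - cov_total N G S \<le> (\<Sum>a\<in>A - S. m a)"
    using cov_total_le_sum_newly_covered[OF fA, of N G S] A(3) by (simp add: m_def)
  also have "\<dots> \<le> (\<Sum>a\<in>A - S. m c + 2 * \<delta>)" using le A(1) by (intro sum_mono) auto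
  also have "\<dots> = real (card (A - S)) * (m c + 2 * \<delta>)" by simp
  also have "\<dots> \<le> real k * (m c + 2 * \<delta>)"
    using nn A(2) card_mono[OF fA, of "A - S"] by (intro mult_right_mono) auto
  finally have "(cov_OPT n N G k - cov_total N G S) / real k \<le> m c + 2 * \<delta>"
    using k by (simp add: divide_le_eq mult.commute)
  then show ?thesis unfolding cov_total_insert by (simp add: m_def algebra_simps diff_divide_distrib)
qed

text \<open>Induction over rounds: the gap bound of the previous round is the good state, and a
  fresh round adds one failure probability through \<open>prob_bind_pmf_failure\<close>.\<close>

lemma fed_discrete_greedy_failure:
  assumes sel: "argmax_rule sel" and k: "1 \<le> k" "k \<le> n" "t \<le> k"
    and G: "\<And>a. a \<in> {1..n} \<Longrightarrow> G a \<subseteq> {1..N}"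
    and OPT: "0 < cov_OPT n N G k"
    and \<kappa>: "0 < \<kappa>" and \<delta>: "0 \<le> \<delta>" "\<delta> \<le> 2 * cov_OPT n N G k"
  shows "measure_pmf.prob
      (fed_discrete_greedy {1..n} (uniform_indep {1..n} k) sel N (cov G) (importance n G) \<kappa> t)
      {x. \<not> cov_OPT n N G k - cov_total N G (fst x)
            \<le> (1 - 1 / real k) ^ t * cov_OPT n N G k + 2 * real t * \<delta>}
    \<le> real t * (real n * (2 * exp (- \<delta>\<^sup>2 * \<kappa> / (4 * (cov_OPT n N G k)\<^sup>2))))"
  using k(3)
proof (induction t)
  case (Suc t)
  define q where "q = real n * (2 * exp (- \<delta>\<^sup>2 * \<kappa> / (4 * (cov_OPT n N G k)\<^sup>2)))"
  define OPT where "OPT = cov_OPT n N G k"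
  let ?r = "fed_discrete_greedy {1..n} (uniform_indep {1..n} k) sel N (cov G) (importance n G) \<kappa>"
  let ?up = "server_update {1..n} (uniform_indep {1..n} k) sel (cov G) (importance n G) \<kappa>"
  define Q where "Q = (\<lambda>t (x :: nat set \<times> nat set list).
    OPT - cov_total N G (fst x) \<le> (1 - 1 / real k) ^ t * OPT + 2 * real t * \<delta>)"
  have IH: "measure_pmf.prob (?r t) {x. \<not> Q t x} \<le> real t * q"
    using Suc by (simp add: Q_def q_def OPT_def)
  \<comment> \<open>Singletons are feasible because \<open>1 \<le> k\<close>, so the optimum is a
    valid bound on group sizes.\<close>
  have size: "real (card (G a)) \<le> cov_OPT n N G k" if "a \<in> {1..n}" for a
    using cov_total_le_OPT[of "{a}" n k N G] cov_total_singleton[of G a N] G[OF that] that k by simp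
  have step: "measure_pmf.prob
      (map_pmf (\<lambda>P. (?up (fst x) P, snd x @ [P])) (participants_pmf N (importance n G) \<kappa>))
      {y. \<not> Q (Suc t) y} \<le> q" if x: "x \<in> set_pmf (?r t)" "Q t x" for x
  proof -
    let ?X = "\<lambda>P e. \<Sum>i\<in>P. client_vector (cov G) (importance n G) \<kappa> (fst x) i e"
    have S: "fst x \<subseteq> {1..n}" "card (fst x) < k"
      using fed_discrete_greedy_set[OF sel k(2), of t "fst x" "snd x"] x(1) Suc.prems by auto
    have "Q (Suc t) (?up (fst x) P, snd x @ [P])"
      if P: "\<And>e. e \<in> {1..n} \<Longrightarrow> \<bar>?X P e - real (card (newly_covered N G (fst x) e))\<bar> < \<delta>" for P
    proof -
      have "OPT - cov_total N G (?up (fst x) P)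
          \<le> (1 - 1 / real k) * (OPT - cov_total N G (fst x)) + 2 * \<delta>"
        unfolding server_update_def OPT_def by (rule greedy_step[OF sel S k(2) P])
      also have "\<dots> \<le> (1 - 1 / real k) * ((1 - 1 / real k) ^ t * OPT + 2 * real t * \<delta>) + 2 * \<delta>"
        using x(2) k by (intro add_right_mono mult_left_mono) (auto simp: Q_def)
      also have "\<dots> = (1 - 1 / real k) ^ Suc t * OPT + (1 - 1 / real k) * (2 * real t * \<delta>) + 2 * \<delta>"
        by (simp add: distrib_left mult.assoc)
      \<comment> \<open>The contraction of earlier errors is given up, so they add linearly to
        \<open>2 * t * \<delta>\<close>.\<close>
      also have "\<dots> \<le> (1 - 1 / real k) ^ Suc t * OPT + 1 * (2 * real t * \<delta>) + 2 * \<delta>"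
        using \<delta> by (intro add_right_mono add_left_mono mult_right_mono) auto
      finally show ?thesis by (simp add: Q_def algebra_simps)
    qed
    then have "measure_pmf.prob
      (map_pmf (\<lambda>P. (?up (fst x) P, snd x @ [P])) (participants_pmf N (importance n G) \<kappa>))
      {y. \<not> Q (Suc t) y} \<le> measure_pmf.prob (participants_pmf N (importance n G) \<kappa>)
      {P. \<exists>e\<in>{1..n}. \<delta> \<le> \<bar>?X P e - real (card (newly_covered N G (fst x) e))\<bar>}"
      unfolding measure_map_pmf by (intro measure_pmf.finite_measure_mono) (force simp: not_le)+
    also have "\<dots> \<le> q"
      unfolding q_def by (rule participants_round_failure[OF G assms(6) size \<kappa> \<delta>])
    finally show ?thesis .
  qed
  have "measure_pmf.prob (?r (Suc t)) {x. \<not> Q (Suc t) x} \<le> real t * q + q"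
    unfolding fed_discrete_greedy.simps case_prod_beta
    by (rule prob_bind_pmf_failure[OF IH _ step]) (auto simp: q_def)
  then show ?case unfolding Q_def OPT_def q_def by (simp add: algebra_simps)
qed simp

lemma power_one_minus_inverse_le: "1 \<le> k \<Longrightarrow> (1 - 1 / real k) ^ k \<le> 1 / exp 1"
  using exp_ge_one_minus_x_over_n_power_n[of 1 k] by (simp add: exp_minus inverse_eq_divide)

text \<open>The threshold on \<open>\<kappa>\<close> makes each estimate fail with probability at
  most \<open>1 / n ^ 3\<close>; there are \<open>k * n \<le> n\<^sup>2\<close> estimates in
  all.\<close>

lemma fed_discrete_greedy_guarantee:
  assumes sel: "argmax_rule sel" and k: "1 \<le> k" "k \<le> n" and \<epsilon>: "0 < \<epsilon>" "\<epsilon> < 1"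
    and G: "\<And>a. a \<in> {1..n} \<Longrightarrow> G a \<subseteq> {1..N}"
    and \<kappa>: "16 * real k * real n * ln (2 * real n ^ 3) / \<epsilon>\<^sup>2 \<le> \<kappa>"
  shows "measure_pmf.prob
      (fed_discrete_greedy {1..n} (uniform_indep {1..n} k) sel N (cov G) (importance n G) \<kappa> k)
      {(S, h). (1 - 1 / exp 1 - \<epsilon>) * cov_OPT n N G k \<le> cov_total N G S} \<ge> 1 - 1 / real n"
\<comment> \<open>The tail bound needs a positive \<open>B\<close>; for optimum 0 the guarantee
  holds for every set.\<close>
proof (cases "cov_OPT n N G k = 0")
  case True
  then show ?thesis by (simp add: cov_total_nonneg)
next
  case False
  define OPT where "OPT = cov_OPT n N G k"
  let ?r = "fed_discrete_greedy {1..n} (uniform_indep {1..n} k) sel N (cov G) (importance n G) \<kappa> k"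
  \<comment> \<open>Chosen so that the total loss \<open>2 * k * \<delta>\<close> equals
    \<open>\<epsilon> * OPT\<close>.\<close>
  define \<delta> where "\<delta> = \<epsilon> * OPT / (2 * real k)"
  have OPT: "0 < OPT" using False cov_OPT_nonneg[of n N G k] by (simp add: OPT_def)
  have n: "1 \<le> real n" using k by simp
  \<comment> \<open>The factor 2 keeps the logarithm positive even for \<open>n = 1\<close>.\<close>
  then have n3: "1 < 2 * real n ^ 3" using one_le_power[of "real n" 3] by linarith
  have "0 < 16 * real k * real n * ln (2 * real n ^ 3) / \<epsilon>\<^sup>2"
    using k \<epsilon> n ln_gt_zero[OF n3] by simp
  then have \<kappa>pos: "0 < \<kappa>" using \<kappa> by simp
  have \<delta>: "0 \<le> \<delta>" "\<delta> \<le> 2 * OPT"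
  proof -
    show "0 \<le> \<delta>" using \<epsilon> OPT by (simp add: \<delta>_def)
    have "\<epsilon> * OPT \<le> 1 * OPT" using \<epsilon> OPT by (intro mult_right_mono) auto
    also have "\<dots> \<le> (4 * real k) * OPT" using k OPT by (intro mult_right_mono) auto
    finally show "\<delta> \<le> 2 * OPT" using k by (simp add: \<delta>_def divide_le_eq algebra_simps)
  qed
  have "ln (2 * real n ^ 3) \<le> \<delta>\<^sup>2 * \<kappa> / (4 * OPT\<^sup>2)"
  proof -
    \<comment> \<open>The exponent requires \<open>k\<^sup>2\<close>, which \<open>k * n\<close>
      dominates.\<close>
    have "(real k * real k) * (16 * ln (2 * real n ^ 3)) \<le> (real k * real n) * (16 * ln (2 * real n ^ 3))"
      using k n3 by (intro mult_right_mono mult_left_mono) auto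
    also have "\<dots> \<le> \<epsilon>\<^sup>2 * \<kappa>" using \<kappa> \<epsilon> by (simp add: divide_le_eq algebra_simps)
    finally have "ln (2 * real n ^ 3) \<le> \<epsilon>\<^sup>2 * \<kappa> / (16 * real k * real k)"
      using k by (simp add: le_divide_eq algebra_simps)
    also have "\<dots> = \<delta>\<^sup>2 * \<kappa> / (4 * OPT\<^sup>2)"
      using OPT k by (simp add: \<delta>_def power2_eq_square field_simps)
    finally show ?thesis .
  qed
  then have "exp (- \<delta>\<^sup>2 * \<kappa> / (4 * OPT\<^sup>2)) \<le> exp (- ln (2 * real n ^ 3))" by simp
  also have "\<dots> = 1 / (2 * real n ^ 3)" using n n3 by (simp add: exp_minus inverse_eq_divide)
  finally have q: "exp (- \<delta>\<^sup>2 * \<kappa> / (4 * OPT\<^sup>2)) \<le> 1 / (2 * real n ^ 3)" .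
  let ?bad = "{x :: nat set \<times> nat set list. \<not> OPT - cov_total N G (fst x)
            \<le> (1 - 1 / real k) ^ k * OPT + 2 * real k * \<delta>}"
  have "measure_pmf.prob ?r ?bad \<le> real k * (real n * (2 * exp (- \<delta>\<^sup>2 * \<kappa> / (4 * OPT\<^sup>2))))"
    using fed_discrete_greedy_failure[OF sel k order_refl G OPT[unfolded OPT_def] \<kappa>pos
        \<delta>[unfolded OPT_def]] unfolding OPT_def .
  also have "\<dots> \<le> real n * (real n * (2 * (1 / (2 * real n ^ 3))))"
    using k q by (intro mult_mono) auto
  also have "\<dots> = 1 / real n" using n by (simp add: power3_eq_cube field_simps)
  finally have "1 - 1 / real n \<le> measure_pmf.prob ?r (- ?bad)"
    by (subst measure_pmf.prob_compl[of ?bad, simplified, folded Compl_eq_Diff_UNIV]) simp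
  also have "\<dots> \<le> measure_pmf.prob ?r {(S, h). (1 - 1 / exp 1 - \<epsilon>) * OPT \<le> cov_total N G S}"
  proof (intro measure_pmf.finite_measure_mono subsetI)
    fix x assume "x \<in> - ?bad"
    then have "OPT - cov_total N G (fst x) \<le> (1 - 1 / real k) ^ k * OPT + 2 * real k * \<delta>"
      by simp
    moreover have "2 * real k * \<delta> = \<epsilon> * OPT" using k by (simp add: \<delta>_def)
    moreover have "(1 - 1 / real k) ^ k * OPT \<le> 1 / exp 1 * OPT"
      using power_one_minus_inverse_le[OF k(1)] OPT by (intro mult_right_mono) auto
    ultimately show "x \<in> {(S, h). (1 - 1 / exp 1 - \<epsilon>) * OPT \<le> cov_total N G S}"
      by (simp add: case_prod_beta algebra_simps)
  qed simp
  finally show ?thesis unfolding OPT_def .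
qed

section \<open>Participation, soft-O bounds and the final assembly\<close>

lemma fed_discrete_greedy_expected_participants:
  assumes "\<And>a. a \<in> {1..n} \<Longrightarrow> G a \<subseteq> {1..N}" "0 \<le> \<kappa>" "t < T"
  shows "measure_pmf.expectation (fed_discrete_greedy E I sel N f (importance n G) \<kappa> T)
      (\<lambda>(S, h). real (card (h ! t))) \<le> \<kappa> * real n"
proof -
  let ?r = "fed_discrete_greedy E I sel N f (importance n G) \<kappa> T"
  have "measure_pmf.expectation ?r (\<lambda>(S, h). real (card (h ! t)))
      = measure_pmf.expectation (map_pmf (\<lambda>(S, h). h ! t) ?r) (\<lambda>P. real (card P))"
    by (simp add: case_prod_unfold)
  also have "\<dots> = measure_pmf.expectation (participants_pmf N (importance n G) \<kappa>) (\<lambda>P. real (card P))"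
    by (simp only: fed_discrete_greedy_history_law[OF assms(3)])
  also have "\<dots> \<le> \<kappa> * real n" by (rule expected_participants_le[OF assms(1,2)])
  finally show ?thesis .
qed

text \<open>From \<open>n \<le> g\<close> follows \<open>2 * n ^ 3 \<le> (2 + g) ^ 4\<close>, so the
  logarithm is at most four times \<open>ln (2 + g)\<close> and one logarithmic factor
  suffices.\<close>

lemma soft_O_log_cube:
  assumes "0 \<le> c" and "\<And>k n \<epsilon>. (k, n, \<epsilon>) \<in> cov_params \<Longrightarrow> real n \<le> g k n \<epsilon>"
  shows "soft_O cov_params (\<lambda>(k, n, \<epsilon>). c * g k n \<epsilon> * ln (2 * real n ^ 3)) (\<lambda>(k, n, \<epsilon>). g k n \<epsilon>)"
  unfolding soft_O_def
\<comment> \<open>The added 1 keeps the constant positive when \<open>c = 0\<close>.\<close>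
proof (intro exI[of _ "4 * c + 1"] conjI exI[of _ 1] ballI)
  show "0 < 4 * c + 1" using assms(1) by simp
  fix x :: "nat \<times> nat \<times> real" assume x: "x \<in> cov_params"
  obtain k n \<epsilon> where [simp]: "x = (k, n, \<epsilon>)" by (cases x)
  have n: "1 \<le> real n" using x by (simp add: cov_params_def)
  have g: "real n \<le> g k n \<epsilon>" using assms(2) x by simp
  define L where "L = ln (2 + g k n \<epsilon>)"
  have L: "0 \<le> L" using g n by (simp add: L_def)
  have n3: "1 \<le> real n ^ 3" using n by (rule one_le_power)
  have "2 * real n ^ 3 \<le> (2 + real n) * (2 + real n) ^ 3"
    using n by (intro mult_mono power_mono) auto
  also have "\<dots> = (2 + real n) ^ 4" by (simp add: power4_eq_xxxx power3_eq_cube)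
  also have "\<dots> \<le> (2 + g k n \<epsilon>) ^ 4" using g by (intro power_mono) auto
  finally have "ln (2 * real n ^ 3) \<le> ln ((2 + g k n \<epsilon>) ^ 4)" using n by (intro ln_mono) auto
  also have "\<dots> = 4 * L" using g n by (simp add: L_def ln_realpow)
  finally have "ln (2 * real n ^ 3) \<le> 4 * L" .
  moreover have "0 \<le> ln (2 * real n ^ 3)" using n3 by simp
  ultimately have "c * g k n \<epsilon> * ln (2 * real n ^ 3) \<le> c * g k n \<epsilon> * (4 * L)"
    using assms(1) g n by (intro mult_left_mono) auto
  also have "\<dots> \<le> (4 * c + 1) * g k n \<epsilon> * L" using L g n by (simp add: algebra_simps)
  finally show "\<bar>(case x of (k, n, \<epsilon>) \<Rightarrow> c * g k n \<epsilon> * ln (2 * real n ^ 3))\<bar>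
      \<le> (4 * c + 1) * \<bar>case x of (k, n, \<epsilon>) \<Rightarrow> g k n \<epsilon>\<bar>
        * ln (2 + \<bar>case x of (k, n, \<epsilon>) \<Rightarrow> g k n \<epsilon>\<bar>) ^ 1"
    using assms(1) g n \<open>0 \<le> ln (2 * real n ^ 3)\<close> by (simp add: L_def abs_of_nonneg)
qed

theorem theoremD4:
  shows "\<exists>(\<kappa> :: nat \<Rightarrow> nat \<Rightarrow> real \<Rightarrow> real) (M :: nat \<Rightarrow> nat \<Rightarrow> real \<Rightarrow> real).
    soft_O cov_params (\<lambda>(k, n, \<epsilon>). \<kappa> k n \<epsilon>) (\<lambda>(k, n, \<epsilon>). real k * real n / \<epsilon>\<^sup>2) \<and>
    soft_O cov_params (\<lambda>(k, n, \<epsilon>). M k n \<epsilon>) (\<lambda>(k, n, \<epsilon>). real k * (real n)\<^sup>2 / \<epsilon>\<^sup>2) \<and>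
    (\<forall>k n \<epsilon>. (k, n, \<epsilon>) \<in> cov_params \<longrightarrow>
       0 < \<kappa> k n \<epsilon> \<and>
       (\<forall>(N::nat) (G :: nat \<Rightarrow> nat set) (sel :: (nat \<Rightarrow> real) \<Rightarrow> nat set \<Rightarrow> nat).
          (\<forall>a\<in>{1..n}. G a \<subseteq> {1..N}) \<and> argmax_rule sel \<longrightarrow>
          (let run = fed_discrete_greedy {1..n} (uniform_indep {1..n} k) sel
                       N (cov G) (importance n G) (\<kappa> k n \<epsilon>) k
           in (\<forall>(S, h) \<in> set_pmf run. S \<subseteq> {1..n} \<and> card S = k) \<and>
              measure_pmf.prob run
                {(S, h). (1 - 1 / exp 1 - \<epsilon>) * cov_OPT n N G k \<le> cov_total N G S}
                \<ge> 1 - 1 / real n \<and>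
              (\<forall>t<k. measure_pmf.expectation run (\<lambda>(S, h). real (card (h ! t))) \<le> M k n \<epsilon>))))"
proof -
  \<comment> \<open>The constant 16 comes from \<open>\<delta>\<^sup>2 / (4 * OPT\<^sup>2) =
    \<epsilon>\<^sup>2 / (16 * k\<^sup>2)\<close> for the chosen \<open>\<delta>\<close>.\<close>
  define \<kappa> :: "nat \<Rightarrow> nat \<Rightarrow> real \<Rightarrow> real" where
    "\<kappa> = (\<lambda>k n \<epsilon>. 16 * (real k * real n / \<epsilon>\<^sup>2) * ln (2 * real n ^ 3))"
  define M :: "nat \<Rightarrow> nat \<Rightarrow> real \<Rightarrow> real" where
    "M = (\<lambda>k n \<epsilon>. 16 * (real k * (real n)\<^sup>2 / \<epsilon>\<^sup>2) * ln (2 * real n ^ 3))"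
  have M: "M k n \<epsilon> = \<kappa> k n \<epsilon> * real n" for k n \<epsilon>
    by (simp add: M_def \<kappa>_def power2_eq_square)
  \<comment> \<open>These bounds let powers of \<open>ln n\<close> be absorbed into logarithms of
    the two target rates.\<close>
  have size: "real n \<le> real k * real n / \<epsilon>\<^sup>2" "real n \<le> real k * (real n)\<^sup>2 / \<epsilon>\<^sup>2"
    if "(k, n, \<epsilon>) \<in> cov_params" for k n \<epsilon>
  proof -
    have p: "1 \<le> real k" "1 \<le> real n" "0 < \<epsilon>" "\<epsilon> < 1" using that by (auto simp: cov_params_def)
    have e: "0 < \<epsilon>\<^sup>2" "\<epsilon>\<^sup>2 \<le> 1" using p by (auto simp: power_le_one)
    have "real n * \<epsilon>\<^sup>2 \<le> real n * 1" using e by (intro mult_left_mono) auto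
    also have "\<dots> \<le> real n * real k" using p by (intro mult_left_mono) auto
    finally have 1: "real n * \<epsilon>\<^sup>2 \<le> real k * real n" by (simp add: mult.commute)
    also have "\<dots> \<le> real k * (real n)\<^sup>2"
      using p by (intro mult_left_mono) (auto simp: power2_eq_square)
    finally have 2: "real n * \<epsilon>\<^sup>2 \<le> real k * (real n)\<^sup>2" .
    show "real n \<le> real k * real n / \<epsilon>\<^sup>2" "real n \<le> real k * (real n)\<^sup>2 / \<epsilon>\<^sup>2"
      using 1 2 e(1) by (simp_all only: pos_le_divide_eq)
  qed
  have pos: "0 < \<kappa> k n \<epsilon>" if "(k, n, \<epsilon>) \<in> cov_params" for k n \<epsilon>
  proof -
    have p: "1 \<le> real k" "1 \<le> real n" "0 < \<epsilon>" using that by (auto simp: cov_params_def)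
    have "1 \<le> real n ^ 3" using p by (intro one_le_power)
    then have "1 < 2 * real n ^ 3" by linarith
    then have "0 < ln (2 * real n ^ 3)" by (rule ln_gt_zero)
    then show ?thesis using p by (simp add: \<kappa>_def)
  qed
  show ?thesis
    unfolding Let_def
  proof (rule exI[of _ \<kappa>], rule exI[of _ M], intro conjI allI impI)
    show "soft_O cov_params (\<lambda>(k, n, \<epsilon>). \<kappa> k n \<epsilon>) (\<lambda>(k, n, \<epsilon>). real k * real n / \<epsilon>\<^sup>2)"
      unfolding \<kappa>_def by (rule soft_O_log_cube) (use size in auto)
    show "soft_O cov_params (\<lambda>(k, n, \<epsilon>). M k n \<epsilon>) (\<lambda>(k, n, \<epsilon>). real k * (real n)\<^sup>2 / \<epsilon>\<^sup>2)"
      unfolding M_def by (rule soft_O_log_cube) (use size in auto)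
    fix k n \<epsilon> assume P: "(k, n, \<epsilon>) \<in> cov_params"
    then have p: "1 \<le> k" "k \<le> n" "0 < \<epsilon>" "\<epsilon> < 1" by (auto simp: cov_params_def)
    show "0 < \<kappa> k n \<epsilon>" by (rule pos[OF P])
    fix N :: nat and G :: "nat \<Rightarrow> nat set" and sel :: "(nat \<Rightarrow> real) \<Rightarrow> nat set \<Rightarrow> nat"
    assume H: "(\<forall>a\<in>{1..n}. G a \<subseteq> {1..N}) \<and> argmax_rule sel"
    then have sel: "argmax_rule sel" and G: "\<And>a. a \<in> {1..n} \<Longrightarrow> G a \<subseteq> {1..N}" by auto
    let ?r = "fed_discrete_greedy {1..n} (uniform_indep {1..n} k) sel N (cov G)
      (importance n G) (\<kappa> k n \<epsilon>) k"
    show "\<forall>(S, h) \<in> set_pmf ?r. S \<subseteq> {1..n} \<and> card S = k"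
      using fed_discrete_greedy_set[OF sel p(2) order_refl] by blast
    show "measure_pmf.prob ?r
        {(S, h). (1 - 1 / exp 1 - \<epsilon>) * cov_OPT n N G k \<le> cov_total N G S} \<ge> 1 - 1 / real n"
      by (rule fed_discrete_greedy_guarantee[OF sel p G]) (simp_all add: \<kappa>_def)
    show "measure_pmf.expectation ?r (\<lambda>(S, h). real (card (h ! t))) \<le> M k n \<epsilon>" if "t < k" for t
      unfolding M using pos[OF P] that
      by (intro fed_discrete_greedy_expected_participants G) auto
  qed
qed

end
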